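(* Let $n\ge 2$, let $\Pi_2^n$ be the set of functions $F=(F_1,\ldots,F_n):\mathbb{R}\to\mathbb{R}^n$ each of whose coordinates is a real polynomial of degree at most $2$, and let $\mathcal{L}=\{F\in\Pi_2^n : F(\mathbb{R})\text{ is contained in a line}\}$. For any $\rho\ge 0$, the subdivision scheme $\mathcal{S}=\{S_k\}_{k\in\mathbb{N}_0}$ with parameter $\rho$ defined in the context reproduces $\mathcal{F}=\Pi_2^n\setminus\mathcal{L}$ on any grid $\xi^0=(\xi^0_i)_{i\in\mathbb{Z}}\subset\mathbb{R}$ (with $\xi^0_i<\xi^0_{i+1}$ for all $i$) fulfilling $$(1+\rho)^{-1}\le \alpha^0_i\le 1+\rho,\qquad i\in\mathbb{Z},\qquad\text{where }\alpha^0_i:=\frac{\xi^0_i-\xi^0_{i-1}}{\xi^0_{i+1}-\xi^0_i}.$$ Moreover, if all the points of $f^0\in\ell(\mathbb{Z},\mathbb{R}^n)$ lie on a line, then all the points of $f^k$ lie on the same line (for every $k\in\mathbb{N}_0$), where $f^{k+1}=S_kf^k$.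
   Context: Notation: $\mathbb{N}_0=\{0,1,2,\ldots\}$; $\ell(\mathbb{Z},\mathbb{R}^n)$ is the set of all sequences $f=(f_i)_{i\in\mathbb{Z}}$ with $f_i\in\mathbb{R}^n$; $\nabla f_i:=f_{i+1}-f_i$; $|\cdot|_2$ is the Euclidean norm. Lagrange rules. For $\alpha,\beta\in(0,+\infty)$ let $$a_{-1}(\alpha,\beta)=-\frac{3(4\beta+3)}{64(\alpha^2+\alpha)(\alpha+\beta+1)},\quad a_0(\alpha,\beta)=\frac{3(4\alpha+1)(4\beta+3)}{64\alpha(\beta+1)},$$ $$a_1(\alpha,\beta)=\frac{(4\alpha+1)(4\beta+3)}{64\beta(\alpha+1)},\quad a_2(\alpha,\beta)=-\frac{3(4\alpha+1)}{64(\beta^2+\beta)(\alpha+\beta+1)},$$ $$\Lambda_0[\alpha,\beta](f_{-1},f_0,f_1,f_2)=\sum_{j=-1}^2 a_j(\alpha,\beta)f_j,\qquad \Lambda_1[\alpha,\beta](f_{-1},f_0,f_1,f_2)=\sum_{j=-1}^2 a_{1-j}(\beta,\alpha)f_j .$$ The scheme with parameter $\rho\ge0$. For $A,B>0$ and $k\in\mathbb{N}_0$ let $$\alpha^k(A,B)=\max\left\{(1+2^{-k}\rho)^{-1},\min\left\{1+2^{-k}\rho,\ \frac{1}{A+\frac{\sqrt{A(A+1)B(B+1)}}{B+1}}\right\}\right\},\qquad \beta^k(A,B)=\alpha^k(B,A).$$ For column vectors $\delta_{-1},\delta_0,\delta_1\in\mathbb{R}^n$ let $$\mathrm{num}=\det\begin{pmatrix}\delta_{-1}^T\delta_0&\delta_{-1}^T\delta_1\\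 \delta_1^T\delta_0&|\delta_1|_2^2\end{pmatrix},\qquad \mathrm{den}=\det\begin{pmatrix}|\delta_{-1}|_2^2&\delta_{-1}^T\delta_1\\ \delta_{-1}^T\delta_1&|\delta_1|_2^2\end{pmatrix},$$ $A(\delta_{-1},\delta_0,\delta_1)=\tfrac12$ if $\mathrm{num}\cdot\mathrm{den}=0$ and $A(\delta_{-1},\delta_0,\delta_1)=|\mathrm{num}/\mathrm{den}|$ otherwise; $B(\delta_{-1},\delta_0,\delta_1)=A(\delta_1,\delta_0,\delta_{-1})$. For $l=0,1$ put $$\Psi^k_l(f_{-1},f_0,f_1,f_2)=\Lambda_l[\bar\alpha,\bar\beta](f_{-1},f_0,f_1,f_2),$$ where $\bar\alpha=\alpha^k(\bar A,\bar B)$, $\bar\beta=\beta^k(\bar A,\bar B)$, $\bar A=A(\nabla f_{-1},\nabla f_0,\nabla f_1)$, $\bar B=B(\nabla f_{-1},\nabla f_0,\nabla f_1)$. The subdivision operators $S_k:\ell(\mathbb{Z},\mathbb{R}^n)\to\ell(\mathbb{Z},\mathbb{R}^n)$ are $(S_kf)_{2i+l}=\Psi^k_l(f_{i-1},f_i,f_{i+1},f_{i+2})$, $l=0,1$, $i\in\mathbb{Z}$, and $\mathcal{S}=\{S_k\}_{k\in\mathbb{N}_0}$. Convergence: a sequence $\{f^k\}_{k\in\mathbb{N}_0}\subset\ell(\mathbb{Z},\mathbb{R}^n)$ converges uniformly to a continuous $G:\mathbb{R}\to\mathbb{R}^n$ iff for every compact interval $I\subset\mathbb{R}$, $\lim_{k\to\infty}\sup_{i\in\mathbb{Z}\cap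 2^kI}|f^k_i-G(i2^{-k})|=0$. Reproduction: $\mathcal{S}$ reproduces a set $\mathcal{F}$ of continuous functions $\mathbb{R}\to\mathbb{R}^n$ on a grid $\xi^0$ iff there exists a strictly increasing $\sigma:\mathbb{R}\to\mathbb{R}$ such that, for every $F\in\mathcal{F}$, the sequence defined by $f^0=(F(\xi^0_i))_{i\in\mathbb{Z}}$, $f^{k+1}=S_kf^k$, converges uniformly to $F\circ\sigma$. *)

theory Defs
  imports "HOL-Analysis.Analysis" "HOL-Computational_Algebra.Polynomial"
begin

text \<open>The type \<open>real ^ 'n\<close> models $n$-dimensional Euclidean space with
  $n$ = \<open>CARD('n)\<close>; its \<open>norm\<close> and \<open>\<bullet>\<close> are the Euclidean ones.
  Bi-infinite sequences are functions \<open>int \<Rightarrow> real ^ 'n\<close>.\<close>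

text \<open>\<open>lagrange_coeff \<alpha> \<beta> j\<close>, for \<open>j = -1, 0, 1, 2\<close>, is the weight of node \<open>j\<close> when the cubic
  Lagrange interpolant on the nodes \<open>-\<alpha>, 0, 1, 1 + \<beta>\<close> is evaluated at \<open>1/4\<close>.
  By symmetry, \<open>lagrange_coeff \<beta> \<alpha> (1 - j)\<close> is the weight for evaluation at \<open>3/4\<close>.\<close>

definition lagrange_coeff :: "real \<Rightarrow> real \<Rightarrow> int \<Rightarrow> real" where
  "lagrange_coeff \<alpha> \<beta> j =
    (if j = -1 then - (3 * (4 * \<beta> + 3)) / (64 * (\<alpha>\<^sup>2 + \<alpha>) * (\<alpha> + \<beta> + 1))
     else if j = 0 then (3 * (4 * \<alpha> + 1) * (4 * \<beta> + 3)) / (64 * \<alpha> * (\<beta> + 1))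
     else if j = 1 then ((4 * \<alpha> + 1) * (4 * \<beta> + 3)) / (64 * \<beta> * (\<alpha> + 1))
     else if j = 2 then - (3 * (4 * \<alpha> + 1)) / (64 * (\<beta>\<^sup>2 + \<beta>) * (\<alpha> + \<beta> + 1))
     else 0)"

definition lagrange_rule ::
  "int \<Rightarrow> real \<Rightarrow> real \<Rightarrow> real ^ 'n \<Rightarrow> real ^ 'n \<Rightarrow> real ^ 'n \<Rightarrow> real ^ 'n \<Rightarrow> real ^ 'n" where
  "lagrange_rule l \<alpha> \<beta> p q r s =
    (if l = 0
     then lagrange_coeff \<alpha> \<beta> (-1) *\<^sub>R p + lagrange_coeff \<alpha> \<beta> 0 *\<^sub>R q
        + lagrange_coeff \<alpha> \<beta> 1 *\<^sub>R r + lagrange_coeff \<alpha> \<beta> 2 *\<^sub>R s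
     else lagrange_coeff \<beta> \<alpha> 2 *\<^sub>R p + lagrange_coeff \<beta> \<alpha> 1 *\<^sub>R q
        + lagrange_coeff \<beta> \<alpha> 0 *\<^sub>R r + lagrange_coeff \<beta> \<alpha> (-1) *\<^sub>R s)"

text \<open>Only applied to \<open>A, B > 0\<close>; the companion parameter is
  $\beta^k(A,B)$ = \<open>alpha_param \<rho> k B A\<close>.\<close>

definition alpha_param :: "real \<Rightarrow> nat \<Rightarrow> real \<Rightarrow> real \<Rightarrow> real" where
  "alpha_param \<rho> k A B =
    max (inverse (1 + \<rho> / 2 ^ k))
      (min (1 + \<rho> / 2 ^ k)
        (1 / (A + sqrt (A * (A + 1) * B * (B + 1)) / (B + 1))))"

definition A_num :: "real ^ 'n \<Rightarrow> real ^ 'n \<Rightarrow> real ^ 'n \<Rightarrow> real" where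
  "A_num d e g = det (vector [vector [d \<bullet> e, d \<bullet> g],
                              vector [g \<bullet> e, (norm g)\<^sup>2]] :: real ^ 2 ^ 2)"

definition A_den :: "real ^ 'n \<Rightarrow> real ^ 'n \<Rightarrow> real ^ 'n \<Rightarrow> real" where
  "A_den d e g = det (vector [vector [(norm d)\<^sup>2, d \<bullet> g],
                              vector [d \<bullet> g, (norm g)\<^sup>2]] :: real ^ 2 ^ 2)"

definition A_coeff :: "real ^ 'n \<Rightarrow> real ^ 'n \<Rightarrow> real ^ 'n \<Rightarrow> real" where
  "A_coeff d e g =
    (if A_num d e g * A_den d e g = 0 then 1 / 2 else \<bar>A_num d e g / A_den d e g\<bar>)"

definition B_coeff :: "real ^ 'n \<Rightarrow> real ^ 'n \<Rightarrow> real ^ 'n \<Rightarrow> real" where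
  "B_coeff d e g = A_coeff g e d"

definition subdiv_rule ::
  "real \<Rightarrow> nat \<Rightarrow> int \<Rightarrow> real ^ 'n \<Rightarrow> real ^ 'n \<Rightarrow> real ^ 'n \<Rightarrow> real ^ 'n \<Rightarrow> real ^ 'n" where
  "subdiv_rule \<rho> k l p q r s =
    (let A = A_coeff (q - p) (r - q) (s - r);
         B = B_coeff (q - p) (r - q) (s - r)
     in lagrange_rule l (alpha_param \<rho> k A B) (alpha_param \<rho> k B A) p q r s)"

text \<open>The entry with index \<open>m = 2 * i + l\<close>, where \<open>l \<in> {0, 1}\<close>,
  has \<open>i = m div 2\<close> and \<open>l = m mod 2\<close> (on \<open>int\<close>, \<open>div\<close> rounds down).\<close>

definition subdiv_op :: "real \<Rightarrow> nat \<Rightarrow> (int \<Rightarrow> real ^ 'n) \<Rightarrow> (int \<Rightarrow> real ^ 'n)" where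
  "subdiv_op \<rho> k f = (\<lambda>m. let i = m div 2; l = m mod 2 in
     subdiv_rule \<rho> k l (f (i - 1)) (f i) (f (i + 1)) (f (i + 2)))"

primrec subdiv_seq ::
  "(nat \<Rightarrow> (int \<Rightarrow> 'a) \<Rightarrow> (int \<Rightarrow> 'a)) \<Rightarrow> (int \<Rightarrow> 'a) \<Rightarrow> nat \<Rightarrow> (int \<Rightarrow> 'a)" where
  "subdiv_seq S f 0 = f"
| "subdiv_seq S f (Suc k) = S k (subdiv_seq S f k)"

text \<open>The supremum is taken in \<open>ennreal\<close>, so that it is \<open>0\<close> when the interval, scaled by
  \<open>2 ^ k\<close>, contains no integer; on \<open>real\<close> the supremum of the empty set is unspecified.\<close>

definition converges_uniformly_to ::
  "(nat \<Rightarrow> int \<Rightarrow> 'a::real_normed_vector) \<Rightarrow> (real \<Rightarrow> 'a) \<Rightarrow> bool" where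
  "converges_uniformly_to f G \<longleftrightarrow>
     continuous_on UNIV G \<and>
     (\<forall>a b. a \<le> b \<longrightarrow>
       (\<lambda>k. SUP i\<in>{i. real_of_int i \<in> (\<lambda>x. 2 ^ k * x) ` {a..b}}.
              ennreal (norm (f k i - G (real_of_int i / 2 ^ k)))) \<longlonglongrightarrow> 0)"

definition reproduces_on ::
  "(nat \<Rightarrow> (int \<Rightarrow> 'a::real_normed_vector) \<Rightarrow> (int \<Rightarrow> 'a)) \<Rightarrow> (real \<Rightarrow> 'a) set
    \<Rightarrow> (int \<Rightarrow> real) \<Rightarrow> bool" where
  "reproduces_on S \<F> \<xi> \<longleftrightarrow>
     (\<exists>\<sigma>::real \<Rightarrow> real. strict_mono \<sigma> \<and>
       (\<forall>F\<in>\<F>. converges_uniformly_to (subdiv_seq S (\<lambda>i. F (\<xi> i))) (F \<circ> \<sigma>)))"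

definition is_line :: "'a::real_vector set \<Rightarrow> bool" where
  "is_line L \<longleftrightarrow> (\<exists>a b. a \<noteq> b \<and> L = affine hull {a, b})"

definition quadratic_maps :: "(real \<Rightarrow> real ^ 'n) set" where
  "quadratic_maps = {F. \<forall>j. \<exists>p::real poly. degree p \<le> 2 \<and> (\<forall>x. F x $ j = poly p x)}"

definition collinear_quadratic_maps :: "(real \<Rightarrow> real ^ 'n) set" where
  "collinear_quadratic_maps = {F \<in> quadratic_maps. \<exists>L. is_line L \<and> range F \<subseteq> L}"

end

theory Submission
  imports Defs
begin

text \<open>
  A non-collinear quadratic curve satisfies \<open>\<delta>\<^sub>0 = A \<delta>\<^sub>-\<^sub>1 + B \<delta>\<^sub>1\<close> for three consecutive chords, where
  \<open>A\<close> and \<open>B\<close> are given by Cramer's rule and depend only on the ratios of the parameter steps; the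
  formula for the parameters of the scheme inverts this dependence. Hence one step of the scheme maps
  samples of \<open>F\<close> on a grid to samples of \<open>F\<close> on the grid refined by Chaikin's corner cutting, as long
  as the clamping is inactive, and it stays inactive because corner cutting at least halves the
  excess \<open>r\<close> in the bounds \<open>(1 + r)\<^sup>-\<^sup>1\<close>, \<open>1 + r\<close> on the step ratios. The reparametrization \<open>\<sigma>\<close> is the
  limit of corner cutting applied to the grid, that is, the quadratic spline with the grid points as
  control points: it is invariant under refinement and its values at \<open>(j - 1)/2\<^sup>k\<close> and \<open>j/2\<^sup>k\<close>
  enclose the \<open>j\<close>-th point of the \<open>k\<close>-th grid.
\<close>

section \<open>Recovering step ratios from chords\<close>

lemma A_num_eq: "A_num d e g = (d \<bullet> e) * (g \<bullet> g) - (d \<bullet> g) * (g \<bullet> e)"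
  by (simp add: A_num_def det_2 dot_square_norm)

lemma A_den_eq: "A_den d e g = (d \<bullet> d) * (g \<bullet> g) - (d \<bullet> g)\<^sup>2"
  by (simp add: A_den_def det_2 dot_square_norm power2_eq_square)

text \<open>Cramer's rule: pairing \<open>e\<close> with \<open>d\<close> and \<open>g\<close> gives
  numerator = \<open>a\<close> times the Gram determinant. Positivity of \<open>a\<close> and the
  nonzero determinant exclude the default 1/2 and make the absolute value harmless.\<close>

lemma A_coeff_combination:
  assumes "e = a *\<^sub>R d + b *\<^sub>R g" "a > 0" "A_den d e g \<noteq> 0"
  shows "A_coeff d e g = a"
proof -
  have "A_num d e g = a * A_den d e g"
    unfolding assms(1) A_num_eq A_den_eq
    by (simp add: inner_simps inner_commute algebra_simps power2_eq_square)
  with assms show ?thesis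
    by (simp add: A_coeff_def)
qed

lemma B_coeff_combination:
  assumes "e = a *\<^sub>R d + b *\<^sub>R g" "b > 0" "A_den d e g \<noteq> 0"
  shows "B_coeff d e g = b"
  unfolding B_coeff_def
proof (rule A_coeff_combination)
  show "e = b *\<^sub>R g + a *\<^sub>R d"
    using assms by simp
  show "A_den g e d \<noteq> 0"
    using assms by (simp add: A_den_eq inner_commute mult.commute)
qed (use assms in simp)

text \<open>A Gram determinant changes by the square of the determinant of the linear substitution,
  here h h' (q - p). Chords of a quadratic curve have exactly this form.\<close>

lemma A_den_combination:
  "A_den (h *\<^sub>R (u + p *\<^sub>R v)) e (h' *\<^sub>R (u + q *\<^sub>R v)) = (h * h' * (q - p))\<^sup>2 * A_den u e v"
  unfolding A_den_eq
  by (simp add: inner_simps inner_commute algebra_simps power2_eq_square)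

text \<open>\<open>A\<close> and \<open>B\<close> are the coefficients of the middle chord of a
  quadratic curve whose parameter steps are in the ratio \<alpha> : 1 : \<beta>; the formula of the
  scheme inverts them because the radicand is a perfect square.\<close>

lemma ratio_recovery:
  fixes \<alpha> \<beta> :: real
  assumes "\<alpha> > 0" "\<beta> > 0"
  defines "A \<equiv> (1 + \<beta>) / (\<alpha> * (\<alpha> + \<beta> + 2))" and "B \<equiv> (1 + \<alpha>) / (\<beta> * (\<alpha> + \<beta> + 2))"
  shows "1 / (A + sqrt (A * (A + 1) * B * (B + 1)) / (B + 1)) = \<alpha>"
proof -
  define s where "s = \<alpha> + \<beta> + 2"
  have s: "s > 0" using assms by (simp add: s_def)
  have pos: "A > 0" "B > 0"
    using assms by (simp_all add: A_def B_def)
  have A1: "A + 1 = (\<alpha> + 1) * (\<alpha> + \<beta> + 1) / (\<alpha> * s)"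
    using assms s unfolding A_def s_def[symmetric] by (simp add: divide_simps) (simp add: s_def algebra_simps)
  have B1: "B + 1 = (\<beta> + 1) * (\<alpha> + \<beta> + 1) / (\<beta> * s)"
    using assms s unfolding B_def s_def[symmetric] by (simp add: divide_simps) (simp add: s_def algebra_simps)
  \<comment> \<open>The factor (\<alpha> + \<beta> + 1) of \<open>A + 1\<close> completes
    \<open>B\<close> to \<open>B + 1\<close>, and what remains is a square.\<close>
  have AB: "A * (A + 1) * B = ((1 + \<alpha>) / (\<alpha> * s))\<^sup>2 * (B + 1)"
    using assms s unfolding A1 B1 unfolding A_def B_def s_def[symmetric]
    by (simp add: divide_simps power2_eq_square add.commute)
  have "A * (A + 1) * B * (B + 1) = ((1 + \<alpha>) / (\<alpha> * s) * (B + 1))\<^sup>2"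
    unfolding AB by (simp add: power2_eq_square)
  then have "sqrt (A * (A + 1) * B * (B + 1)) = (1 + \<alpha>) / (\<alpha> * s) * (B + 1)"
    using assms s pos by simp
  then have "A + sqrt (A * (A + 1) * B * (B + 1)) / (B + 1) = A + (1 + \<alpha>) / (\<alpha> * s)"
    using pos by simp
  also have "\<dots> = 1 / \<alpha>"
    using assms s unfolding A_def s_def[symmetric] by (simp add: divide_simps) (simp add: s_def)
  finally show ?thesis by simp
qed

lemma alpha_param_ratio:
  assumes "\<alpha> > 0" "\<beta> > 0" "inverse (1 + \<rho> / 2 ^ k) \<le> \<alpha>" "\<alpha> \<le> 1 + \<rho> / 2 ^ k"
  shows "alpha_param \<rho> k ((1 + \<beta>) / (\<alpha> * (\<alpha> + \<beta> + 2))) ((1 + \<alpha>) / (\<beta> * (\<alpha> + \<beta> + 2))) = \<alpha>"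
  using assms unfolding alpha_param_def ratio_recovery[OF assms(1,2)] by simp

section \<open>Moments of the Lagrange weights\<close>

text \<open>Interpolation on the nodes -\<alpha>, 0, 1, 1 + \<beta> is exact for 1, x and x^2, so
  the weights have the moments of evaluation at 1/4. The proof clears the common denominator
  \<open>D\<close>.\<close>

lemma lagrange_coeff_moments:
  fixes \<alpha> \<beta> :: real
  assumes "\<alpha> > 0" "\<beta> > 0"
  shows "lagrange_coeff \<alpha> \<beta> (-1) + lagrange_coeff \<alpha> \<beta> 0 + lagrange_coeff \<alpha> \<beta> 1
      + lagrange_coeff \<alpha> \<beta> 2 = 1"
    and "lagrange_coeff \<alpha> \<beta> (-1) * (-\<alpha>) + lagrange_coeff \<alpha> \<beta> 1
      + lagrange_coeff \<alpha> \<beta> 2 * (1 + \<beta>) = 1/4"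
    and "lagrange_coeff \<alpha> \<beta> (-1) * (-\<alpha>)\<^sup>2 + lagrange_coeff \<alpha> \<beta> 1
      + lagrange_coeff \<alpha> \<beta> 2 * (1 + \<beta>)\<^sup>2 = 1/16"
proof -
  define D where "D = 64 * \<alpha> * \<beta> * (\<alpha> + 1) * (\<beta> + 1) * (\<alpha> + \<beta> + 1)"
  have nz: "\<alpha> \<noteq> 0" "\<beta> \<noteq> 0" "\<alpha> + 1 \<noteq> 0" "\<beta> + 1 \<noteq> 0" "\<alpha> + \<beta> + 1 \<noteq> 0" and
    sq: "\<alpha>\<^sup>2 + \<alpha> = \<alpha> * (\<alpha> + 1)" "\<beta>\<^sup>2 + \<beta> = \<beta> * (\<beta> + 1)"
    using assms by (auto simp: power2_eq_square algebra_simps)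
  then have D: "D \<noteq> 0"
    by (simp add: D_def)
  have common: "p / q = p * c / D" if "q * c = D" for p q c
    using that D by auto
  have weights:
    "lagrange_coeff \<alpha> \<beta> (-1) = - (3 * (4 * \<beta> + 3)) * (\<beta> * (\<beta> + 1)) / D"
    "lagrange_coeff \<alpha> \<beta> 0
      = 3 * (4 * \<alpha> + 1) * (4 * \<beta> + 3) * (\<beta> * (\<alpha> + 1) * (\<alpha> + \<beta> + 1)) / D"
    "lagrange_coeff \<alpha> \<beta> 1
      = (4 * \<alpha> + 1) * (4 * \<beta> + 3) * (\<alpha> * (\<beta> + 1) * (\<alpha> + \<beta> + 1)) / D"
    "lagrange_coeff \<alpha> \<beta> 2 = - (3 * (4 * \<alpha> + 1)) * (\<alpha> * (\<alpha> + 1)) / D"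
    unfolding lagrange_coeff_def sq by (simp_all only: simp_thms if_True if_False)
      (simp, rule common, simp add: D_def)+
  have of_common: "p / D = c" if "p = c * D" for p c
    using that D by simp
  note sums = times_divide_eq_left add_divide_distrib[symmetric]
  show "lagrange_coeff \<alpha> \<beta> (-1) + lagrange_coeff \<alpha> \<beta> 0 + lagrange_coeff \<alpha> \<beta> 1
      + lagrange_coeff \<alpha> \<beta> 2 = 1"
    unfolding weights sums by (rule of_common) (simp add: D_def, algebra)
  show "lagrange_coeff \<alpha> \<beta> (-1) * (-\<alpha>) + lagrange_coeff \<alpha> \<beta> 1
      + lagrange_coeff \<alpha> \<beta> 2 * (1 + \<beta>) = 1/4"
    unfolding weights sums by (rule of_common) (simp add: D_def, algebra)
  show "lagrange_coeff \<alpha> \<beta> (-1) * (-\<alpha>)\<^sup>2 + lagrange_coeff \<alpha> \<beta> 1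
      + lagrange_coeff \<alpha> \<beta> 2 * (1 + \<beta>)\<^sup>2 = 1/16"
    unfolding weights sums by (rule of_common) (simp add: D_def, algebra)
qed

lemma weighted_quadratic:
  fixes c d e :: "'a::real_vector"
  shows "w *\<^sub>R (c + x *\<^sub>R d + x\<^sup>2 *\<^sub>R e) + w' *\<^sub>R (c + x' *\<^sub>R d + x'\<^sup>2 *\<^sub>R e)
      + w'' *\<^sub>R (c + x'' *\<^sub>R d + x''\<^sup>2 *\<^sub>R e) + w''' *\<^sub>R (c + x''' *\<^sub>R d + x'''\<^sup>2 *\<^sub>R e)
    = (w + w' + w'' + w''') *\<^sub>R c + (w * x + w' * x' + w'' * x'' + w''' * x''') *\<^sub>R d
      + (w * x\<^sup>2 + w' * x'\<^sup>2 + w'' * x''\<^sup>2 + w''' * x'''\<^sup>2) *\<^sub>R e"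
  by (simp add: algebra_simps)

lemma lagrange_rule_quadratic:
  fixes c d e :: "real ^ 'n"
  assumes "\<alpha> > 0" "\<beta> > 0"
  defines "Q \<equiv> \<lambda>x. c + x *\<^sub>R d + x\<^sup>2 *\<^sub>R e"
  shows "lagrange_rule 0 \<alpha> \<beta> (Q (-\<alpha>)) (Q 0) (Q 1) (Q (1 + \<beta>)) = Q (1/4)"
    and "lagrange_rule 1 \<alpha> \<beta> (Q (-\<alpha>)) (Q 0) (Q 1) (Q (1 + \<beta>)) = Q (3/4)"
proof -
  note m = lagrange_coeff_moments[OF assms(1,2)] and m' = lagrange_coeff_moments[OF assms(2,1)]
  let ?v = "lagrange_coeff \<alpha> \<beta>" and ?w = "lagrange_coeff \<beta> \<alpha>"
  \<comment> \<open>The trivial factors 0 and 1 stay written out so that these equations rewrite the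
    sums in \<open>weighted_quadratic\<close> literally.\<close>
  have v0: "?v (-1) + ?v 0 + ?v 1 + ?v 2 = 1"
    and v1: "?v (-1) * (-\<alpha>) + ?v 0 * 0 + ?v 1 * 1 + ?v 2 * (1 + \<beta>) = 1/4"
    and v2: "?v (-1) * (-\<alpha>)\<^sup>2 + ?v 0 * 0\<^sup>2 + ?v 1 * 1\<^sup>2 + ?v 2 * (1 + \<beta>)\<^sup>2 = 1/16"
    using m by simp_all
  show "lagrange_rule 0 \<alpha> \<beta> (Q (-\<alpha>)) (Q 0) (Q 1) (Q (1 + \<beta>)) = Q (1/4)"
    by (simp only: Q_def lagrange_rule_def weighted_quadratic v0 v1 v2 refl if_True)
      (simp add: power2_eq_square)
  \<comment> \<open>The second rule is the first one after the reflection x -> 1 - x, which swaps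
    \<alpha> with \<beta> and 1/4 with 3/4; its moments are linear combinations of those in
    \<open>m'\<close>.\<close>
  have w0: "?w 2 + ?w 1 + ?w 0 + ?w (-1) = 1"
    using m'(1) by simp
  have w1: "?w 2 * (-\<alpha>) + ?w 1 * 0 + ?w 0 * 1 + ?w (-1) * (1 + \<beta>) = 3/4"
    using m'(1,2) by (simp add: algebra_simps)
  have w2: "?w 2 * (-\<alpha>)\<^sup>2 + ?w 1 * 0\<^sup>2 + ?w 0 * 1\<^sup>2 + ?w (-1) * (1 + \<beta>)\<^sup>2 = 9/16"
    using m' by (simp add: algebra_simps power2_eq_square)
  show "lagrange_rule 1 \<alpha> \<beta> (Q (-\<alpha>)) (Q 0) (Q 1) (Q (1 + \<beta>)) = Q (3/4)"
    by (simp only: Q_def lagrange_rule_def weighted_quadratic w0 w1 w2 one_neq_zero if_False)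
      (simp add: power2_eq_square)
qed

text \<open>The weights sum to 1, so each rule forms an affine combination, whatever the positive
  parameters are.\<close>

lemma lagrange_rule_affine:
  fixes d e :: "real ^ 'n"
  assumes "\<alpha> > 0" "\<beta> > 0"
  shows "\<exists>u. lagrange_rule l \<alpha> \<beta> (d + x *\<^sub>R e) (d + y *\<^sub>R e) (d + z *\<^sub>R e) (d + w *\<^sub>R e) = d + u *\<^sub>R e"
proof -
  have comb: "w0 *\<^sub>R (d + x *\<^sub>R e) + w1 *\<^sub>R (d + y *\<^sub>R e) + w2 *\<^sub>R (d + z *\<^sub>R e) + w3 *\<^sub>R (d + w *\<^sub>R e)
      = d + (w0 * x + w1 * y + w2 * z + w3 * w) *\<^sub>R e"
    if "w0 + w1 + w2 + w3 = 1" for w0 w1 w2 w3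
  proof -
    have "d = (w0 + w1 + w2 + w3) *\<^sub>R d"
      using that by simp
    then show ?thesis
      by (simp add: algebra_simps)
  qed
  show ?thesis
    using lagrange_coeff_moments(1)[OF assms] lagrange_coeff_moments(1)[OF assms(2,1)]
    unfolding lagrange_rule_def
    by (cases "l = 0") (auto intro!: exI comb)
qed

section \<open>Data on a line\<close>

text \<open>The lower clamp is positive for arbitrary \<open>A\<close> and \<open>B\<close>.
  Collinear data, whose Gram determinants vanish, therefore also lead to admissible Lagrange
  parameters.\<close>

lemma alpha_param_pos:
  assumes "\<rho> \<ge> 0"
  shows "alpha_param \<rho> k A B > 0"
proof -
  have "0 < inverse (1 + \<rho> / 2 ^ k)"
    using assms by (simp add: add_pos_nonneg)
  also have "\<dots> \<le> alpha_param \<rho> k A B"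
    by (simp add: alpha_param_def)
  finally show ?thesis .
qed

lemma subdiv_op_line:
  fixes f :: "int \<Rightarrow> real ^ 'n"
  assumes "\<rho> \<ge> 0" "is_line L" "range f \<subseteq> L"
  shows "range (subdiv_op \<rho> k f) \<subseteq> L"
proof -
  obtain a b where L: "L = range (\<lambda>u. a + u *\<^sub>R (b - a))"
    using assms(2) unfolding is_line_def affine_hull_2_alt by blast
  then have "\<forall>i. \<exists>u. f i = a + u *\<^sub>R (b - a)"
    using assms(3) by blast
  then obtain t where f: "f = (\<lambda>i. a + t i *\<^sub>R (b - a))"
    by metis
  show ?thesis
    unfolding L f subdiv_op_def subdiv_rule_def Let_def
    using lagrange_rule_affine[OF alpha_param_pos alpha_param_pos, OF assms(1) assms(1)]
    by blast
qed

lemma subdiv_seq_line: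
  fixes f :: "int \<Rightarrow> real ^ 'n"
  assumes "\<rho> \<ge> 0" "is_line L" "range f \<subseteq> L"
  shows "range (subdiv_seq (subdiv_op \<rho>) f k) \<subseteq> L"
proof (induction k)
  case (Suc k)
  then show ?case
    using subdiv_op_line[OF assms(1,2)] by simp
qed (use assms in simp)

section \<open>Corner cutting of grids\<close>

definition grid_step :: "(int \<Rightarrow> real) \<Rightarrow> int \<Rightarrow> real" where
  "grid_step \<xi> i = \<xi> (i + 1) - \<xi> i"

text \<open>The ratio condition is stated without division, which keeps it linear in the steps;
  \<open>r\<close> is the excess over a uniform grid.\<close>

definition graded :: "real \<Rightarrow> (int \<Rightarrow> real) \<Rightarrow> bool" where
  "graded r \<xi> \<longleftrightarrow> (\<forall>i. grid_step \<xi> i > 0 \<and> grid_step \<xi> i \<le> (1 + r) * grid_step \<xi> (i + 1)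
    \<and> grid_step \<xi> (i + 1) \<le> (1 + r) * grid_step \<xi> i)"

text \<open>The fractions 1/4 and 3/4 are the places where the two Lagrange rules evaluate the
  interpolant.\<close>

definition chaikin :: "(int \<Rightarrow> real) \<Rightarrow> int \<Rightarrow> real" where
  "chaikin \<xi> m = \<xi> (m div 2) + (if even m then 1/4 else 3/4) * grid_step \<xi> (m div 2)"

lemma chaikin_even: "chaikin \<xi> (2 * i) = \<xi> i + grid_step \<xi> i / 4"
  and chaikin_odd: "chaikin \<xi> (2 * i + 1) = \<xi> i + 3 * grid_step \<xi> i / 4"
  by (simp_all add: chaikin_def)

lemma grid_step_chaikin_even: "grid_step (chaikin \<xi>) (2 * i) = grid_step \<xi> i / 2"
  unfolding grid_step_def[of "chaikin \<xi>"] chaikin_even chaikin_odd by simp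

lemma grid_step_chaikin_odd:
  "grid_step (chaikin \<xi>) (2 * i + 1) = (grid_step \<xi> i + grid_step \<xi> (i + 1)) / 4"
proof -
  have "chaikin \<xi> (2 * i + 1 + 1) = \<xi> (i + 1) + grid_step \<xi> (i + 1) / 4"
    using chaikin_even[of \<xi> "i + 1"] by (simp add: algebra_simps)
  then show ?thesis
    unfolding grid_step_def[of "chaikin \<xi>"] chaikin_odd by (simp add: grid_step_def field_simps)
qed

text \<open>Since \<open>b\<close> is at least a / (1 + r), the claim comes down to 1 + r \<le> (1 +
  r/2)^2.\<close>

lemma half_excess_bound:
  fixes a b r :: real
  assumes "a \<le> (1 + r) * b" "a > 0" "b > 0" "r \<ge> 0"
  shows "a / 2 \<le> (1 + r / 2) * ((a + b) / 4)"
proof -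
  have "2 * a * (1 + r) \<le> (1 + r / 2) * (a + b) * (1 + r)"
  proof -
    have "(1 + r / 2) * a \<le> (1 + r / 2) * ((1 + r) * b)"
      using assms by (intro mult_left_mono) auto
    moreover have "0 \<le> r\<^sup>2 * a" using assms by simp
    ultimately show ?thesis by (simp add: field_simps power2_eq_square)
  qed
  then have "2 * a \<le> (1 + r / 2) * (a + b)"
    using assms by (simp add: mult_le_cancel_right)
  then show ?thesis by simp
qed

text \<open>Every pair of neighbouring new steps consists of half an old step and a quarter of the
  sum of two old steps. Bounding the latter by the former is linear in the hypothesis; the converse
  bound is \<open>half_excess_bound\<close>.\<close>

lemma graded_chaikin:
  assumes "graded r \<xi>" "r \<ge> 0"
  shows "graded (r / 2) (chaikin \<xi>)"
  unfolding graded_def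
proof (intro allI)
  fix m :: int
  let ?h = "grid_step (chaikin \<xi>)"
  obtain i where m: "m = 2 * i \<or> m = 2 * i + 1"
    by (metis evenE oddE)
  let ?a = "grid_step \<xi> i" and ?b = "grid_step \<xi> (i + 1)"
  have g: "?a > 0" "?b > 0" "?a \<le> (1 + r) * ?b" "?b \<le> (1 + r) * ?a"
    using assms(1) by (auto simp: graded_def)
  have next_even: "2 * i + 1 + 1 = 2 * (i + 1)"
    by simp
  have h: "?h (2 * i) = ?a / 2" "?h (2 * i + 1) = (?a + ?b) / 4" "?h (2 * i + 1 + 1) = ?b / 2"
    unfolding next_even grid_step_chaikin_even grid_step_chaikin_odd by simp_all
  show "0 < ?h m \<and> ?h m \<le> (1 + r / 2) * ?h (m + 1) \<and> ?h (m + 1) \<le> (1 + r / 2) * ?h m"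
    using m
  proof
    assume m: "m = 2 * i"
    show ?thesis
      unfolding m h using g half_excess_bound[OF g(3,1,2) assms(2)] by (simp add: algebra_simps)
  next
    assume m: "m = 2 * i + 1"
    show ?thesis
      unfolding m h using g half_excess_bound[OF g(4,2,1) assms(2)] by (simp add: algebra_simps)
  qed
qed

text \<open>For r = \<rho> the excess at level k is the one allowed by the clamping of the k-th
  operator, so the clamp never acts.\<close>

lemma graded_chaikin_iterate:
  assumes "graded r \<xi>" "r \<ge> 0"
  shows "graded (r / 2 ^ k) ((chaikin ^^ k) \<xi>)"
proof (induction k)
  case (Suc k)
  then show ?case
    using graded_chaikin[of "r / 2 ^ k"] assms(2) by (simp add: mult.commute)
qed (use assms in simp)

lemma ratio_bounds:
  fixes R h a :: real
  assumes "R > 0" "h > 0"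
  shows "inverse R \<le> a / h \<longleftrightarrow> h \<le> R * a" and "a / h \<le> R \<longleftrightarrow> a \<le> R * h"
  using assms by (simp_all add: field_simps)

section \<open>Samples of quadratic curves\<close>

text \<open>One local step: from samples at parameter distances h \<alpha>, h, h \<beta> the rule
  recovers \<alpha> and \<beta> and then interpolates the curve exactly. The determinant condition
  says that \<open>u\<close> and \<open>v\<close> are linearly independent.\<close>

lemma subdiv_rule_quadratic:
  fixes u v w :: "real ^ 'n"
  assumes "h > 0" "\<alpha> > 0" "\<beta> > 0" "A_den u 0 v \<noteq> 0"
    and "inverse (1 + \<rho> / 2 ^ k) \<le> \<alpha>" "\<alpha> \<le> 1 + \<rho> / 2 ^ k"
    and "inverse (1 + \<rho> / 2 ^ k) \<le> \<beta>" "\<beta> \<le> 1 + \<rho> / 2 ^ k"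
  defines "F \<equiv> \<lambda>x. w + x *\<^sub>R u + x\<^sup>2 *\<^sub>R v"
  shows "subdiv_rule \<rho> k 0 (F (x - h * \<alpha>)) (F x) (F (x + h)) (F (x + h + h * \<beta>)) = F (x + h / 4)"
    and "subdiv_rule \<rho> k 1 (F (x - h * \<alpha>)) (F x) (F (x + h)) (F (x + h + h * \<beta>)) = F (x + 3 * h / 4)"
proof -
  let ?s = "\<alpha> + \<beta> + 2"
  define A B where "A = (1 + \<beta>) / (\<alpha> * ?s)" and "B = (1 + \<alpha>) / (\<beta> * ?s)"
  define d e g where "d = F x - F (x - h * \<alpha>)" and "e = F (x + h) - F x"
    and "g = F (x + h + h * \<beta>) - F (x + h)"
  have d: "d = (h * \<alpha>) *\<^sub>R (u + (2 * x - h * \<alpha>) *\<^sub>R v)"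
    by (simp add: d_def F_def algebra_simps power2_eq_square)
  have e: "e = h *\<^sub>R (u + (2 * x + h) *\<^sub>R v)"
    by (simp add: e_def F_def algebra_simps power2_eq_square)
  have g: "g = (h * \<beta>) *\<^sub>R (u + (2 * x + 2 * h + h * \<beta>) *\<^sub>R v)"
    by (simp add: g_def F_def algebra_simps power2_eq_square)
  have s: "?s > 0" using assms by simp
  have "A > 0" "B > 0"
    using assms by (simp_all add: A_def B_def)
  \<comment> \<open>\<open>sum1\<close> and \<open>sum2\<close> are the \<open>u\<close>- and
    \<open>v\<close>-components of e = A d + B g divided by \<open>h\<close>; solving them yields
    the chosen \<open>A\<close> and \<open>B\<close>.\<close>
  have sum1: "A * \<alpha> + B * \<beta> = 1"
    using assms s unfolding A_def B_def by (simp add: divide_simps)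
  have sum2: "A * \<alpha> * (2 * x - h * \<alpha>) + B * \<beta> * (2 * x + 2 * h + h * \<beta>) = 2 * x + h"
  proof -
    have AB: "A * \<alpha> = (1 + \<beta>) / ?s" "B * \<beta> = (1 + \<alpha>) / ?s"
      using assms by (simp_all add: A_def B_def)
    show ?thesis
      unfolding AB using s by (simp add: divide_simps) (simp add: algebra_simps)
  qed
  have comb: "e = A *\<^sub>R d + B *\<^sub>R g"
  proof -
    have "A *\<^sub>R d + B *\<^sub>R g = h *\<^sub>R ((A * \<alpha> + B * \<beta>) *\<^sub>R u
        + (A * \<alpha> * (2 * x - h * \<alpha>) + B * \<beta> * (2 * x + 2 * h + h * \<beta>)) *\<^sub>R v)"
      unfolding d g by (simp add: algebra_simps)
    then show ?thesis
      unfolding sum1 sum2 e by simp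
  qed
  have "2 * x + 2 * h + h * \<beta> - (2 * x - h * \<alpha>) = h * ?s"
    by (simp add: algebra_simps)
  then have den: "A_den d e g \<noteq> 0"
    using assms(1-4) s unfolding d g A_den_combination by (simp add: A_den_eq)
  have AB: "A_coeff d e g = A" "B_coeff d e g = B"
    using A_coeff_combination[OF comb \<open>A > 0\<close> den] B_coeff_combination[OF comb \<open>B > 0\<close> den]
    by simp_all
  have \<alpha>: "alpha_param \<rho> k A B = \<alpha>" and \<beta>: "alpha_param \<rho> k B A = \<beta>"
    using alpha_param_ratio[of \<alpha> \<beta>] alpha_param_ratio[of \<beta> \<alpha>] assms
    unfolding A_def B_def by (simp_all add: add.commute)
  have rule: "subdiv_rule \<rho> k l (F (x - h * \<alpha>)) (F x) (F (x + h)) (F (x + h + h * \<beta>))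
    = lagrange_rule l \<alpha> \<beta> (F (x - h * \<alpha>)) (F x) (F (x + h)) (F (x + h + h * \<beta>))" for l
    unfolding subdiv_rule_def d_def[symmetric] e_def[symmetric] g_def[symmetric] AB Let_def \<alpha> \<beta> ..
  \<comment> \<open>Expansion of \<open>F\<close> about \<open>x\<close> in the variable t with x +
    h t as argument, which moves the samples to the normalized nodes.\<close>
  define Q where "Q t = F x + t *\<^sub>R (h *\<^sub>R (u + (2 * x) *\<^sub>R v)) + t\<^sup>2 *\<^sub>R (h\<^sup>2 *\<^sub>R v)" for t
  have F: "F (x + h * t) = Q t" for t
    by (simp add: F_def Q_def algebra_simps power2_eq_square)
  have Fs: "F (x - h * \<alpha>) = Q (-\<alpha>)" "F x = Q 0" "F (x + h) = Q 1" "F (x + h + h * \<beta>) = Q (1 + \<beta>)"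
    "F (x + h / 4) = Q (1/4)" "F (x + 3 * h / 4) = Q (3/4)"
    unfolding F[symmetric] by (simp_all add: algebra_simps)
  show "subdiv_rule \<rho> k 0 (F (x - h * \<alpha>)) (F x) (F (x + h)) (F (x + h + h * \<beta>)) = F (x + h / 4)"
    unfolding rule unfolding Fs unfolding Q_def by (rule lagrange_rule_quadratic(1)[OF assms(2,3)])
  show "subdiv_rule \<rho> k 1 (F (x - h * \<alpha>)) (F x) (F (x + h)) (F (x + h + h * \<beta>)) = F (x + 3 * h / 4)"
    unfolding rule unfolding Fs unfolding Q_def by (rule lagrange_rule_quadratic(2)[OF assms(2,3)])
qed

lemma subdiv_op_quadratic:
  fixes u v w :: "real ^ 'n"
  assumes "A_den u 0 v \<noteq> 0" "graded (\<rho> / 2 ^ k) \<xi>" "\<rho> \<ge> 0"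
  defines "F \<equiv> \<lambda>x. w + x *\<^sub>R u + x\<^sup>2 *\<^sub>R v"
  shows "subdiv_op \<rho> k (\<lambda>i. F (\<xi> i)) = (\<lambda>i. F (chaikin \<xi> i))"
proof
  fix m :: int
  define i h where "i = m div 2" and "h = grid_step \<xi> i"
  define \<alpha> \<beta> where "\<alpha> = grid_step \<xi> (i - 1) / h" and "\<beta> = grid_step \<xi> (i + 1) / h"
  let ?R = "1 + \<rho> / 2 ^ k"
  have R: "?R > 0" using assms(3) by (simp add: add_pos_nonneg)
  have "grid_step \<xi> (i - 1) \<le> ?R * h" "h \<le> ?R * grid_step \<xi> (i - 1)"
    "grid_step \<xi> (i + 1) \<le> ?R * h" "h \<le> ?R * grid_step \<xi> (i + 1)" and
    pos: "grid_step \<xi> (i - 1) > 0" "h > 0" "grid_step \<xi> (i + 1) > 0"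
    \<comment> \<open>Grading is used at i - 1 and at i; the cancellation law identifies i - 1 + 1
      with i.\<close>
    using assms(2) diff_add_cancel[of i 1] unfolding graded_def h_def by metis+
  then have bounds: "\<alpha> > 0" "\<beta> > 0" "inverse ?R \<le> \<alpha>" "\<alpha> \<le> ?R" "inverse ?R \<le> \<beta>" "\<beta> \<le> ?R"
    unfolding \<alpha>_def \<beta>_def ratio_bounds[OF R pos(2)] by simp_all
  have pts: "\<xi> (i - 1) = \<xi> i - h * \<alpha>" "\<xi> (i + 1) = \<xi> i + h" "\<xi> (i + 2) = \<xi> i + h + h * \<beta>"
    using pos unfolding \<alpha>_def \<beta>_def by (simp_all add: h_def grid_step_def add.assoc)
  note rule = subdiv_rule_quadratic[OF pos(2) bounds(1,2) assms(1) bounds(3-6), of w "\<xi> i"]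
  show "subdiv_op \<rho> k (\<lambda>i. F (\<xi> i)) m = F (chaikin \<xi> m)"
  proof (cases "even m")
    case True
    then have "m mod 2 = 0"
      by presburger
    with True show ?thesis
      using rule(1) unfolding subdiv_op_def Let_def i_def[symmetric] pts F_def
      by (simp add: chaikin_def i_def[symmetric] h_def[symmetric])
  next
    case False
    then have "m mod 2 = 1"
      by presburger
    with False show ?thesis
      using rule(2) unfolding subdiv_op_def Let_def i_def[symmetric] pts F_def
      by (simp add: chaikin_def i_def[symmetric] h_def[symmetric])
  qed
qed

lemma subdiv_seq_quadratic:
  fixes u v w :: "real ^ 'n"
  assumes "A_den u 0 v \<noteq> 0" "graded \<rho> \<xi>" "\<rho> \<ge> 0"
  defines "F \<equiv> \<lambda>x. w + x *\<^sub>R u + x\<^sup>2 *\<^sub>R v"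
  shows "subdiv_seq (subdiv_op \<rho>) (\<lambda>i. F (\<xi> i)) k = (\<lambda>i. F ((chaikin ^^ k) \<xi> i))"
proof (induction k)
  case (Suc k)
  then show ?case
    using subdiv_op_quadratic[OF assms(1) graded_chaikin_iterate[OF assms(2,3)] assms(3), where w = w]
    by (simp add: F_def)
qed simp

section \<open>Vector form of quadratic maps and the meaning of non-collinearity\<close>

lemma quadratic_maps_form:
  fixes F :: "real \<Rightarrow> real ^ 'n"
  assumes "F \<in> quadratic_maps"
  obtains w u v where "F = (\<lambda>x. w + x *\<^sub>R u + x\<^sup>2 *\<^sub>R v)"
proof -
  obtain p :: "'n \<Rightarrow> real poly" where p: "\<And>j. degree (p j) \<le> 2" "\<And>j x. F x $ j = poly (p j) x"
    using assms unfolding quadratic_maps_def mem_Collect_eq by metis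
  have "poly q x = coeff q 0 + x * coeff q 1 + x\<^sup>2 * coeff q 2" if "degree q \<le> 2"
    for q :: "real poly" and x
  proof -
    have "poly q x = poly (\<Sum>i\<le>2. monom (coeff q i) i) x"
      using poly_as_sum_of_monoms'[OF that] by simp
    then show ?thesis
      by (simp add: poly_sum poly_monom numeral_2_eq_2 mult.commute)
  qed
  then have "F x = (\<chi> j. coeff (p j) 0) + x *\<^sub>R (\<chi> j. coeff (p j) 1) + x\<^sup>2 *\<^sub>R (\<chi> j. coeff (p j) 2)" for x
    using p by (simp add: vec_eq_iff)
  then show ?thesis
    using that by blast
qed

text \<open>A vanishing Gram determinant is equality in the Cauchy-Schwarz inequality. The common
  direction \<open>d\<close> is required to be nonzero because it has to span a line.\<close>

lemma A_den_zero_dependent: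
  fixes u v :: "real ^ 'n"
  assumes "A_den u e v = 0"
  obtains d a b where "d \<noteq> 0" "u = a *\<^sub>R d" "v = b *\<^sub>R d"
proof -
  have "(u \<bullet> v)\<^sup>2 = (norm u * norm v)\<^sup>2"
    using assms by (simp add: A_den_eq dot_square_norm power_mult_distrib)
  then have "\<bar>u \<bullet> v\<bar> = norm u * norm v"
    by (metis abs_mult abs_norm_cancel power2_eq_iff_nonneg abs_ge_zero power2_abs)
  then have "u = 0 \<or> v = 0 \<or> (\<exists>c. v = c *\<^sub>R u)"
    by (simp add: norm_cauchy_schwarz_equal collinear_lemma)
  then consider "u = 0" "v = 0" | "u \<noteq> 0" "\<exists>c. v = c *\<^sub>R u" | "v \<noteq> 0" "u = 0"
    by (metis scale_zero_left)
  then show ?thesis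
  proof cases
    case 1
    \<comment> \<open>For u = v = 0 any nonzero direction serves; the all-ones vector is
      taken.\<close>
    have "(1 :: real ^ 'n) \<noteq> 0" by simp
    with 1 show ?thesis
      using that[of 1 0 0] by simp
  next
    case 2
    then show ?thesis
      using that[of u 1] by auto
  next
    case 3
    then show ?thesis
      using that[of v 0 1] by simp
  qed
qed

text \<open>With dependent \<open>u\<close> and \<open>v\<close> the curve stays on the line through
  \<open>w\<close> with direction \<open>d\<close>; this includes constant curves.\<close>

lemma noncollinear_A_den:
  fixes w u v :: "real ^ 'n"
  defines "F \<equiv> \<lambda>x::real. w + x *\<^sub>R u + x\<^sup>2 *\<^sub>R v"
  assumes "F \<in> quadratic_maps - collinear_quadratic_maps"
  shows "A_den u 0 v \<noteq> 0"
proof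
  assume "A_den u 0 v = 0"
  then obtain d a b where d: "d \<noteq> 0" "u = a *\<^sub>R d" "v = b *\<^sub>R d"
    by (rule A_den_zero_dependent)
  have "is_line (affine hull {w, w + d})"
    using d(1) unfolding is_line_def by (metis add_cancel_right_right)
  moreover have "F x = w + (a * x + b * x\<^sup>2) *\<^sub>R ((w + d) - w)" for x
    unfolding F_def d by (simp add: algebra_simps)
  then have "range F \<subseteq> affine hull {w, w + d}"
    unfolding affine_hull_2_alt by blast
  ultimately show False
    using assms(2) by (auto simp: collinear_quadratic_maps_def)
qed

section \<open>The limit spline\<close>

text \<open>A piece of the uniform quadratic B-spline: it starts at the midpoint of two control
  points, and its slope runs linearly from one grid step to the next.\<close>

definition spline_piece :: "(int \<Rightarrow> real) \<Rightarrow> int \<Rightarrow> real \<Rightarrow> real" where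
  "spline_piece \<xi> i t = (\<xi> i + \<xi> (i + 1)) / 2 + grid_step \<xi> i * t
    + (grid_step \<xi> (i + 1) - grid_step \<xi> i) * t\<^sup>2 / 2"

definition spline :: "(int \<Rightarrow> real) \<Rightarrow> real \<Rightarrow> real" where
  "spline \<xi> x = spline_piece \<xi> \<lfloor>x\<rfloor> (frac x)"

lemma spline_of_int: "spline \<xi> (of_int i) = (\<xi> i + \<xi> (i + 1)) / 2"
  by (simp add: spline_def spline_piece_def)

text \<open>Consecutive pieces agree at the common midpoint, so each piece is valid on its closed
  interval although the floor selects the next one at the right end.\<close>

lemma spline_on_interval:
  assumes "of_int i \<le> x" "x \<le> of_int i + 1"
  shows "spline \<xi> x = spline_piece \<xi> i (x - of_int i)"
proof (cases "x = of_int i + 1")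
  case True
  then have "spline \<xi> x = (\<xi> (i + 1) + \<xi> (i + 1 + 1)) / 2"
    using spline_of_int[of \<xi> "i + 1"] by simp
  also have "\<dots> = spline_piece \<xi> i 1"
    by (simp add: spline_piece_def grid_step_def field_simps)
  finally show ?thesis
    using True by simp
next
  case False
  then have "\<lfloor>x\<rfloor> = i"
    using assms by (simp add: floor_unique)
  then show ?thesis
    by (simp add: spline_def frac_def)
qed

text \<open>Corner cutting is the refinement rule of the quadratic B-spline: each piece splits at t
  = 1/2 into the pieces 2i and 2i + 1 of the refined control points.\<close>

lemma spline_chaikin: "spline (chaikin \<xi>) (2 * x) = spline \<xi> x"
proof -
  define i t where "i = \<lfloor>x\<rfloor>" and "t = frac x"
  have x: "x = of_int i + t" "0 \<le> t" "t < 1"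
    by (simp_all add: i_def t_def frac_def frac_lt_1 floor_le_iff) linarith+
  have step3: "grid_step (chaikin \<xi>) (2 * i + 1 + 1) = grid_step \<xi> (i + 1) / 2"
    and pt3: "chaikin \<xi> (2 * i + 1 + 1) = \<xi> (i + 1) + grid_step \<xi> (i + 1) / 4"
    using grid_step_chaikin_even[of \<xi> "i + 1"] chaikin_even[of \<xi> "i + 1"] by (simp_all add: algebra_simps)
  show ?thesis
  proof (cases "t \<le> 1/2")
    case True
    have "spline (chaikin \<xi>) (2 * x) = spline_piece (chaikin \<xi>) (2 * i) (2 * t)"
      using True x by (subst spline_on_interval[of "2 * i"]) auto
    also have "\<dots> = spline_piece \<xi> i t"
      unfolding spline_piece_def grid_step_chaikin_even grid_step_chaikin_odd chaikin_even chaikin_odd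
      by (simp add: grid_step_def field_simps)
    finally show ?thesis
      by (simp add: spline_def i_def t_def)
  next
    case False
    have "spline (chaikin \<xi>) (2 * x) = spline_piece (chaikin \<xi>) (2 * i + 1) (2 * t - 1)"
      using False x by (subst spline_on_interval[of "2 * i + 1"]) auto
    also have "\<dots> = spline_piece \<xi> i t"
      unfolding spline_piece_def step3 pt3 grid_step_chaikin_odd chaikin_odd
      by (simp add: grid_step_def field_simps power2_eq_square)
    finally show ?thesis
      by (simp add: spline_def i_def t_def)
  qed
qed

lemma spline_chaikin_iterate: "spline ((chaikin ^^ k) \<xi>) (2 ^ k * x) = spline \<xi> x"
proof (induction k)
  case (Suc k)
  then show ?case
    using spline_chaikin[of "(chaikin ^^ k) \<xi>" "2 ^ k * x"] by (simp add: mult.assoc)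
qed simp

lemma isCont_spline: "isCont (spline \<xi>) x"
proof -
  have cont: "continuous_on {of_int i .. of_int i + 1} (spline \<xi>)" for i :: int
  proof -
    have "continuous_on {of_int i .. of_int i + 1} (\<lambda>x. spline_piece \<xi> i (x - of_int i))"
      unfolding spline_piece_def by (intro continuous_intros) simp_all
    then show ?thesis
      by (rule continuous_on_eq) (metis spline_on_interval atLeastAtMost_iff)
  qed
  define i where "i = \<lfloor>x\<rfloor>"
  \<comment> \<open>The interval to the left is included because \<open>x\<close> may be the integer
    \<open>i\<close> itself; the union is then a neighbourhood of \<open>x\<close>.\<close>
  have "continuous_on ({of_int (i - 1) .. of_int (i - 1) + 1} \<union> {of_int i .. of_int i + 1}) (spline \<xi>)"
    by (intro continuous_on_closed_Un cont closed_atLeastAtMost)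
  then have "continuous_on {of_int i - 1 <..< of_int i + 1} (spline \<xi>)"
    by (rule continuous_on_subset) auto
  moreover have "x \<in> {of_int i - 1 <..< of_int i + 1}"
    unfolding i_def by simp linarith
  ultimately show ?thesis
    by (simp add: continuous_on_eq_continuous_at)
qed

text \<open>The difference quotient of a quadratic is its slope at the midpoint \<open>c\<close>,
  here a convex combination of two positive steps.\<close>

lemma spline_piece_strict_mono:
  assumes "\<And>i. grid_step \<xi> i > 0" "0 \<le> s" "s < t" "t \<le> 1"
  shows "spline_piece \<xi> i s < spline_piece \<xi> i t"
proof -
  define c where "c = (s + t) / 2"
  have "0 < grid_step \<xi> i * (1 - c) + grid_step \<xi> (i + 1) * c"
    using assms by (intro add_pos_pos mult_pos_pos) (auto simp: c_def)
  then have "0 < (t - s) * (grid_step \<xi> i * (1 - c) + grid_step \<xi> (i + 1) * c)"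
    using assms(3) by (intro mult_pos_pos) auto
  also have "\<dots> = spline_piece \<xi> i t - spline_piece \<xi> i s"
    by (simp add: spline_piece_def c_def field_simps power2_eq_square)
  finally show ?thesis by simp
qed

lemma strict_mono_spline:
  assumes step: "\<And>i. grid_step \<xi> i > 0"
  shows "strict_mono (spline \<xi>)"
proof (rule strict_monoI)
  fix x y :: real
  assume "x < y"
  have mono: "spline \<xi> (of_int i) \<le> spline \<xi> (of_int j)" if "i \<le> j" for i j
    using that
  proof (induction j rule: int_ge_induct)
    case (step j)
    have "\<xi> j < \<xi> (j + 1)" "\<xi> (j + 1) < \<xi> (j + 1 + 1)"
      using assms[of j] assms[of "j + 1"] by (simp_all add: grid_step_def)
    then show ?case
      using step spline_of_int[of \<xi> j] spline_of_int[of \<xi> "j + 1"] by simp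
  qed simp
  have piece: "spline \<xi> s < spline \<xi> t" if "of_int i \<le> s" "s < t" "t \<le> of_int i + 1" for i s t
    using that spline_on_interval[of i s \<xi>] spline_on_interval[of i t \<xi>]
      spline_piece_strict_mono[OF step, of "s - of_int i" "t - of_int i" i] by simp
  show "spline \<xi> x < spline \<xi> y"
  proof (cases "\<lfloor>x\<rfloor> = \<lfloor>y\<rfloor>")
    case True
    have "of_int \<lfloor>x\<rfloor> \<le> x" "y \<le> of_int \<lfloor>x\<rfloor> + 1"
      using True by linarith+
    then show ?thesis
      using piece \<open>x < y\<close> by blast
  next
    case False
    then have le: "\<lfloor>x\<rfloor> + 1 \<le> \<lfloor>y\<rfloor>"
      using \<open>x < y\<close> floor_mono[of x y] by linarith
    \<comment> \<open>The comparison passes through the integers \<lfloor>x\<rfloor> + 1 and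
      \<lfloor>y\<rfloor>; only this first link has to be strict.\<close>
    have "spline \<xi> x < spline \<xi> (of_int (\<lfloor>x\<rfloor> + 1))"
      using piece[of "\<lfloor>x\<rfloor>" x "of_int (\<lfloor>x\<rfloor> + 1)"] real_of_int_floor_add_one_gt[of x] by simp
    also have "\<dots> \<le> spline \<xi> (of_int \<lfloor>y\<rfloor>)"
      using mono[OF le] .
    also have "\<dots> \<le> spline \<xi> y"
    proof (cases "of_int \<lfloor>y\<rfloor> < y")
      case True
      then show ?thesis
        using piece[of "\<lfloor>y\<rfloor>" "of_int \<lfloor>y\<rfloor>" y] real_of_int_floor_add_one_ge[of y] by simp
    next
      case False
      then have "real_of_int \<lfloor>y\<rfloor> = y"
        using of_int_floor_le[of y] by linarith
      then show ?thesis
        by (simp only: order_refl)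
    qed
    finally show ?thesis .
  qed
qed

text \<open>By refinement invariance the spline values at (j - 1)/2^k and j/2^k are the midpoints of
  the level-k grid on either side of its j-th point; the intermediate value theorem then gives
  \<open>y\<close>.\<close>

lemma chaikin_point_on_spline:
  assumes "graded r \<xi>" "r \<ge> 0"
  obtains y where "(of_int j - 1) / 2 ^ k \<le> y" "y \<le> of_int j / 2 ^ k" "(chaikin ^^ k) \<xi> j = spline \<xi> y"
proof -
  let ?\<eta> = "(chaikin ^^ k) \<xi>"
  have \<sigma>: "spline \<xi> (of_int m / 2 ^ k) = (?\<eta> m + ?\<eta> (m + 1)) / 2" for m
    using spline_chaikin_iterate[of k \<xi> "of_int m / 2 ^ k"] by (simp add: spline_of_int)
  have "grid_step ?\<eta> (j - 1) > 0" "grid_step ?\<eta> j > 0"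
    using graded_chaikin_iterate[OF assms] unfolding graded_def by blast+
  then have "spline \<xi> (of_int (j - 1) / 2 ^ k) \<le> ?\<eta> j" "?\<eta> j \<le> spline \<xi> (of_int j / 2 ^ k)"
    unfolding \<sigma> by (simp_all add: grid_step_def)
  moreover have "of_int (j - 1) / 2 ^ k \<le> (of_int j / 2 ^ k :: real)"
    by (simp add: divide_right_mono)
  ultimately obtain y where "of_int (j - 1) / 2 ^ k \<le> y" "y \<le> of_int j / 2 ^ k" "spline \<xi> y = ?\<eta> j"
    using IVT[of "spline \<xi>" _ "?\<eta> j"] isCont_spline by blast
  then show ?thesis
    using that by simp
qed

section \<open>Uniform convergence and reproduction\<close>

lemma converges_uniformly_chaikin:
  fixes F :: "real \<Rightarrow> 'a::real_normed_vector"
  assumes "graded r \<xi>" "r \<ge> 0" "continuous_on UNIV F"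
  shows "converges_uniformly_to (\<lambda>k i. F ((chaikin ^^ k) \<xi> i)) (F \<circ> spline \<xi>)"
  unfolding converges_uniformly_to_def
proof (intro conjI allI impI)
  let ?G = "F \<circ> spline \<xi>"
  have "continuous_on UNIV (spline \<xi>)"
    by (simp add: continuous_at_imp_continuous_on isCont_spline)
  then show G: "continuous_on UNIV ?G"
    using assms(3) by (intro continuous_on_compose) (auto intro: continuous_on_subset)
  fix a b :: real
  assume "a \<le> b"
  show "(\<lambda>k. SUP i\<in>{i. real_of_int i \<in> (\<lambda>x. 2 ^ k * x) ` {a..b}}.
          ennreal (norm (F ((chaikin ^^ k) \<xi> i) - ?G (real_of_int i / 2 ^ k)))) \<longlonglongrightarrow> 0"
  proof (rule tendsto_zero_ennreal)
    fix \<epsilon> :: real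
    assume "\<epsilon> > 0"
    \<comment> \<open>The interval is enlarged to the left because \<open>y\<close> may precede
      i/2^k by up to 2^-k \<le> 1.\<close>
    have "uniformly_continuous_on {a - 1..b} ?G"
      using G by (intro compact_uniformly_continuous) (auto intro: continuous_on_subset)
    \<comment> \<open>Half of \<epsilon> is used since passing to the supremum preserves only a weak
      inequality.\<close>
    then obtain \<delta> where "\<delta> > 0" and \<delta>: "\<And>x y. x \<in> {a - 1..b} \<Longrightarrow> y \<in> {a - 1..b} \<Longrightarrow> dist y x < \<delta>
        \<Longrightarrow> dist (?G y) (?G x) < \<epsilon> / 2"
      using \<open>\<epsilon> > 0\<close> unfolding uniformly_continuous_on_def by (metis half_gt_zero)
    have "\<forall>\<^sub>F k in sequentially. (1/2 :: real) ^ k < \<delta>"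
      using \<open>\<delta> > 0\<close> by (intro order_tendstoD(2)[OF LIMSEQ_power_zero]) auto
    then show "\<forall>\<^sub>F k in sequentially. (SUP i\<in>{i. real_of_int i \<in> (\<lambda>x. 2 ^ k * x) ` {a..b}}.
          ennreal (norm (F ((chaikin ^^ k) \<xi> i) - ?G (real_of_int i / 2 ^ k)))) < ennreal \<epsilon>"
    proof eventually_elim
      case (elim k)
      have "(SUP i\<in>{i. real_of_int i \<in> (\<lambda>x. 2 ^ k * x) ` {a..b}}.
          ennreal (norm (F ((chaikin ^^ k) \<xi> i) - ?G (real_of_int i / 2 ^ k)))) \<le> ennreal (\<epsilon> / 2)"
      proof (rule SUP_least)
        fix i
        assume "i \<in> {i. real_of_int i \<in> (\<lambda>x. 2 ^ k * x) ` {a..b}}"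
        then have i: "real_of_int i / 2 ^ k \<in> {a..b}"
          by (auto simp: field_simps)
        obtain y where y: "(of_int i - 1) / 2 ^ k \<le> y" "y \<le> of_int i / 2 ^ k"
          "(chaikin ^^ k) \<xi> i = spline \<xi> y"
          using chaikin_point_on_spline[OF assms(1,2)] .
        have near: "of_int i / 2 ^ k - (1/2) ^ k \<le> y"
          using y(1) by (simp add: diff_divide_distrib power_one_over)
        moreover have "(1/2 :: real) ^ k \<le> 1"
          by (simp add: power_le_one)
        ultimately have "y \<in> {a - 1..b}"
          using i y(2) unfolding atLeastAtMost_iff by linarith
        moreover have "dist y (of_int i / 2 ^ k) < \<delta>"
          using near y(2) elim unfolding dist_real_def by linarith
        ultimately have "dist (?G y) (?G (of_int i / 2 ^ k)) < \<epsilon> / 2"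
          using i by (intro \<delta>) auto
        then show "ennreal (norm (F ((chaikin ^^ k) \<xi> i) - ?G (real_of_int i / 2 ^ k))) \<le> ennreal (\<epsilon> / 2)"
          using y(3) by (intro ennreal_leI) (simp add: dist_norm)
      qed
      also have "\<dots> < ennreal \<epsilon>"
        using \<open>\<epsilon> > 0\<close> by (simp add: ennreal_less_iff)
      finally show ?case .
    qed
  qed
qed

lemma reproduces_on_graded:
  assumes "graded \<rho> \<xi>" "\<rho> \<ge> 0"
  shows "reproduces_on (subdiv_op \<rho>)
    (quadratic_maps - collinear_quadratic_maps :: (real \<Rightarrow> real ^ 'n) set) \<xi>"
  unfolding reproduces_on_def
\<comment> \<open>The witness depends on the grid alone, so it serves all curves \<open>F\<close> at
  once.\<close>
proof (intro exI[of _ "spline \<xi>"] conjI ballI)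
  show "strict_mono (spline \<xi>)"
    using assms(1) by (intro strict_mono_spline) (simp add: graded_def)
  fix F :: "real \<Rightarrow> real ^ 'n"
  assume F: "F \<in> quadratic_maps - collinear_quadratic_maps"
  then obtain w u v where Feq: "F = (\<lambda>x. w + x *\<^sub>R u + x\<^sup>2 *\<^sub>R v)"
    by (auto elim: quadratic_maps_form)
  have "subdiv_seq (subdiv_op \<rho>) (\<lambda>i. F (\<xi> i)) = (\<lambda>k i. F ((chaikin ^^ k) \<xi> i))"
    using subdiv_seq_quadratic[OF noncollinear_A_den[OF F[unfolded Feq]] assms, of w]
    unfolding Feq by blast
  moreover have "continuous_on UNIV F"
    unfolding Feq by (intro continuous_intros)
  ultimately show "converges_uniformly_to (subdiv_seq (subdiv_op \<rho>) (\<lambda>i. F (\<xi> i))) (F \<circ> spline \<xi>)"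
    using converges_uniformly_chaikin[OF assms] by simp
qed

lemma graded_of_ratios:
  assumes "\<rho> \<ge> 0" "\<And>i. \<xi> i < \<xi> (i + 1)"
    and "\<And>i. inverse (1 + \<rho>) \<le> (\<xi> i - \<xi> (i - 1)) / (\<xi> (i + 1) - \<xi> i)"
    and "\<And>i. (\<xi> i - \<xi> (i - 1)) / (\<xi> (i + 1) - \<xi> i) \<le> 1 + \<rho>"
  shows "graded \<rho> \<xi>"
  unfolding graded_def
proof (intro allI)
  fix i
  have pos: "grid_step \<xi> i > 0" "grid_step \<xi> (i + 1) > 0"
    using assms(2)[of i] assms(2)[of "i + 1"] by (simp_all add: grid_step_def)
  have "inverse (1 + \<rho>) \<le> grid_step \<xi> i / grid_step \<xi> (i + 1)"
    "grid_step \<xi> i / grid_step \<xi> (i + 1) \<le> 1 + \<rho>"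
    \<comment> \<open>The ratio with index i + 1 compares the grid steps i and i + 1.\<close>
    using assms(3)[of "i + 1"] assms(4)[of "i + 1"] by (simp_all add: grid_step_def)
  then show "grid_step \<xi> i > 0 \<and> grid_step \<xi> i \<le> (1 + \<rho>) * grid_step \<xi> (i + 1)
    \<and> grid_step \<xi> (i + 1) \<le> (1 + \<rho>) * grid_step \<xi> i"
    using assms(1) pos ratio_bounds[of "1 + \<rho>"] by simp
qed

theorem theorem15:
  fixes \<rho> :: real
  assumes "CARD('n::finite) \<ge> 2" and "\<rho> \<ge> 0"
  shows
    "(\<forall>\<xi>::int \<Rightarrow> real.
        (\<forall>i. \<xi> i < \<xi> (i + 1)) \<longrightarrow>
        (\<forall>i. inverse (1 + \<rho>) \<le> (\<xi> i - \<xi> (i - 1)) / (\<xi> (i + 1) - \<xi> i) \<and>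
             (\<xi> i - \<xi> (i - 1)) / (\<xi> (i + 1) - \<xi> i) \<le> 1 + \<rho>) \<longrightarrow>
        reproduces_on (subdiv_op \<rho>)
          (quadratic_maps - collinear_quadratic_maps :: (real \<Rightarrow> real ^ 'n) set) \<xi>) \<and>
     (\<forall>(f0::int \<Rightarrow> real ^ 'n) L.
        is_line L \<longrightarrow> range f0 \<subseteq> L \<longrightarrow>
        (\<forall>k. range (subdiv_seq (subdiv_op \<rho>) f0 k) \<subseteq> L))"
proof (intro conjI allI impI)
  fix \<xi> :: "int \<Rightarrow> real"
  assume "\<forall>i. \<xi> i < \<xi> (i + 1)"
    and "\<forall>i. inverse (1 + \<rho>) \<le> (\<xi> i - \<xi> (i - 1)) / (\<xi> (i + 1) - \<xi> i) \<and>
      (\<xi> i - \<xi> (i - 1)) / (\<xi> (i + 1) - \<xi> i) \<le> 1 + \<rho>"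
  then have "graded \<rho> \<xi>"
    using graded_of_ratios[OF assms(2)] by simp
  then show "reproduces_on (subdiv_op \<rho>)
      (quadratic_maps - collinear_quadratic_maps :: (real \<Rightarrow> real ^ 'n) set) \<xi>"
    using reproduces_on_graded assms(2) by blast
qed (rule subdiv_seq_line[OF assms(2)])

end
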